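(* Let $A\in\mathbb{R}\setminus\{0\}$ and $B,a_0,b_0\in\mathbb{R}$ with $a_0+b_0=B$, and put $a(\epsilon)=a_0+\frac{A}{\epsilon}$, $b(\epsilon)=b_0-\frac{A}{\epsilon}$ for $\epsilon\in(0,1]$; assume $b(\epsilon)\ne0$ for all $\epsilon\in(0,1]$. Let $L>0$, let $0\neq\psi\in L^2(\mathbb{R},dx)$ have support contained in $[-L,L]$, let $p_0=\frac{\pi}{AL}$ and let $q_0\in\mathbb{R}$ satisfy $|q_0p_0|<2\pi$. Suppose there is a constant $\chi>0$ with $\sum_{n\in\mathbb{Z}}|\psi(x+nq_0)|^2=\chi$ for all $x\in\mathbb{R}$. Then for any $f\in L^2(\mathbb{R},dx)$, $$\lim_{\epsilon\to0^+}\sum_{n,m\in\mathbb{Z}}\big|\langle f|\psi^{\epsilon,a(\epsilon),b(\epsilon)}_{(n,m)}\rangle\big|^2=\sum_{n,m\in\mathbb{Z}}\big|\langle f|\psi^{A,B}_{(n,m)}\rangle\big|^2.$$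
   Context: Heisenberg side: $\eta^{A,B}$ is the representation on $L^2(\mathbb{R})$ of the Heisenberg group $H$ ($\mathbb{R}\times\mathbb{R}^2$ with product $(x_1,(y_1,z_1))(x_2,(y_2,z_2))=(x_1+x_2,(y_1+y_2+x_1z_2,z_1+z_2))$) given by $(\eta^{A,B}(c,(v_1,v_2))f)(x)=e^{i[A(v_1+xv_2)+Bv_2]}f(c+x)$, and $|\psi^{A,B}_{(n,m)}\rangle=\eta^{A,B}\big(nq_0,(\tfrac{nq_0mp_0}{2},mp_0)\big)\psi$. Extended affine side: for $\epsilon\in(0,1]$, $a\in\mathbb{R}$, $b\ne0$, $\rho_\epsilon^{a,b}$ is the representation on $L^2(\mathbb{R})$ of $EA=\mathbb{R}^+\times\mathbb{R}\times\mathbb{R}$ (product $(\alpha,\beta,\gamma)(x,y,z)=(\alpha x,\alpha y+\beta,\gamma+z)$) given by $(\rho_\epsilon^{a,b}(\alpha,\beta,\gamma)f)(x)=e^{ia\gamma}e^{ib\beta e^{-\epsilon x}}f\big(x-\tfrac{\log\alpha}{\epsilon}\big)$. Put $\alpha_n(\epsilon)=e^{-\epsilon nq_0}$, $\beta_{mn}(\epsilon)=-\frac{2\pi m\,e^{-\epsilon nq_0}}{b(\epsilon)(e^{\epsilon L}-e^{-\epsilon L})}$, $\gamma_{mn}(\epsilon)=\beta_{mn}(\epsilon)\frac{\ln\alpha_n(\epsilon)}{\alpha_n(\epsilon)-1}$ (the quotient is $1$ when $\alpha_n(\epsilon)=1$), $Q_\epsilon(x)=e^{-\frac12\epsilon x}$,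 and $|\psi^{\epsilon,a(\epsilon),b(\epsilon)}_{(n,m)}\rangle=\rho_\epsilon^{a(\epsilon),b(\epsilon)}(\alpha_n(\epsilon),\beta_{mn}(\epsilon),\gamma_{mn}(\epsilon))(Q_\epsilon\psi)$. *)

theory Defs
  imports "HOL-Analysis.Analysis"
begin

text \<open>
  Elements of $L^2(R)$ are represented by Borel square-integrable functions; equality of classes
  is equality almost everywhere.
\<close>

definition L2 :: "(real \<Rightarrow> complex) set" where
  "L2 = {f. f \<in> borel_measurable lborel \<and> integrable lborel (\<lambda>x. (norm (f x))\<^sup>2)}"

text \<open>Bra-ket convention: conjugate-linear in the first argument.\<close>

definition braket :: "(real \<Rightarrow> complex) \<Rightarrow> (real \<Rightarrow> complex) \<Rightarrow> complex" where
  "braket f g = (LINT x|lborel. cnj (f x) * g x)"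

fun heis_rep ::
  "real \<Rightarrow> real \<Rightarrow> real \<times> (real \<times> real) \<Rightarrow> (real \<Rightarrow> complex) \<Rightarrow> (real \<Rightarrow> complex)" where
  "heis_rep A B (c, (v1, v2)) f = (\<lambda>x. cis (A * (v1 + x * v2) + B * v2) * f (c + x))"

definition heis_state ::
  "real \<Rightarrow> real \<Rightarrow> real \<Rightarrow> real \<Rightarrow> (real \<Rightarrow> complex) \<Rightarrow> int \<Rightarrow> int \<Rightarrow> (real \<Rightarrow> complex)" where
  "heis_state A B q0 p0 \<psi> n m =
     heis_rep A B (of_int n * q0, (of_int n * q0 * of_int m * p0 / 2, of_int m * p0)) \<psi>"

text \<open>
  A group element $(\alpha, \beta, \gamma)$ has $\alpha > 0$; the formula is only used for such
  triples.
\<close>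

fun aff_rep ::
  "real \<Rightarrow> real \<Rightarrow> real \<Rightarrow> real \<times> real \<times> real \<Rightarrow> (real \<Rightarrow> complex) \<Rightarrow> (real \<Rightarrow> complex)" where
  "aff_rep \<epsilon> a b (\<alpha>, \<beta>, \<gamma>) f =
     (\<lambda>x. cis (a * \<gamma>) * cis (b * \<beta> * exp (- \<epsilon> * x)) * f (x - ln \<alpha> / \<epsilon>))"

definition aff_alpha :: "real \<Rightarrow> real \<Rightarrow> int \<Rightarrow> real" where
  "aff_alpha \<epsilon> q0 n = exp (- \<epsilon> * of_int n * q0)"

definition aff_beta :: "real \<Rightarrow> real \<Rightarrow> real \<Rightarrow> real \<Rightarrow> int \<Rightarrow> int \<Rightarrow> real" where
  "aff_beta \<epsilon> b L q0 n m =
     - (2 * pi * of_int m * exp (- \<epsilon> * of_int n * q0)) / (b * (exp (\<epsilon> * L) - exp (- \<epsilon> * L)))"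

definition aff_gamma :: "real \<Rightarrow> real \<Rightarrow> real \<Rightarrow> real \<Rightarrow> int \<Rightarrow> int \<Rightarrow> real" where
  "aff_gamma \<epsilon> b L q0 n m =
     aff_beta \<epsilon> b L q0 n m *
       (let \<alpha> = aff_alpha \<epsilon> q0 n in if \<alpha> = 1 then 1 else ln \<alpha> / (\<alpha> - 1))"

definition aff_Q :: "real \<Rightarrow> real \<Rightarrow> real" where
  "aff_Q \<epsilon> x = exp (- (1 / 2) * \<epsilon> * x)"

definition aff_state ::
  "real \<Rightarrow> real \<Rightarrow> real \<Rightarrow> real \<Rightarrow> real \<Rightarrow> (real \<Rightarrow> complex) \<Rightarrow> int \<Rightarrow> int \<Rightarrow> (real \<Rightarrow> complex)" where
  "aff_state \<epsilon> a b L q0 \<psi> n m =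
     aff_rep \<epsilon> a b (aff_alpha \<epsilon> q0 n, aff_beta \<epsilon> b L q0 n m, aff_gamma \<epsilon> b L q0 n m)
       (\<lambda>x. of_real (aff_Q \<epsilon> x) * \<psi> x)"

end

theory Submission
  imports Defs
begin

text \<open>
  Both sums can be computed.  After the translation \<open>y = x + n q\<^sub>0\<close>, every coefficient is, up to a
  phase and a constant, the integral of \<open>f (y - n q\<^sub>0) * cnj (\<psi> y)\<close> over \<open>[-L, L]\<close> against the
  conjugate of \<open>w y * cis (m * \<theta> y)\<close>, where \<open>\<theta>' = w\<^sup>2\<close> and \<open>\<theta>\<close> increases by \<open>2 * pi\<close> over the
  interval: \<open>\<theta> y = pi * y / L\<close> on the Heisenberg side, \<open>\<theta> y = - 2 * pi * exp (- \<epsilon> * y) / D\<close> with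
  \<open>D = exp (\<epsilon> * L) - exp (- \<epsilon> * L)\<close> on the affine side, where the factor \<open>Q\<^sub>\<epsilon>\<close> is exactly what
  makes \<open>w\<close> a square root of \<open>\<theta>'\<close>.  Such systems are orthogonal and complete, so Parseval's identity
  and the tiling condition give \<open>2 * L * \<kappa> * \<parallel>f\<parallel>\<^sup>2\<close> and \<open>(D / \<epsilon>) * \<kappa> * \<parallel>f\<parallel>\<^sup>2\<close>, and \<open>D / \<epsilon>\<close> tends
  to \<open>2 * L\<close>.
\<close>

subsection \<open>Parseval's identity for dense orthonormal systems\<close>

text \<open>The measure is a parameter because the notion is used both on \<open>lborel\<close> and
  on its restriction to a compact interval.\<close>

definition square_integrable :: "'a measure \<Rightarrow> ('a \<Rightarrow> complex) \<Rightarrow> bool" where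
  "square_integrable M f \<longleftrightarrow> f \<in> borel_measurable M \<and> integrable M (\<lambda>x. (norm (f x))\<^sup>2)"

lemma square_integrable_measurable [measurable_dest]:
  "square_integrable M f \<Longrightarrow> f \<in> borel_measurable M"
  by (simp add: square_integrable_def)

lemma square_integrable_norm: "square_integrable M f \<Longrightarrow> integrable M (\<lambda>x. (norm (f x))\<^sup>2)"
  by (simp add: square_integrable_def)

lemma square_integrable_bound:
  assumes "f \<in> borel_measurable M" "integrable M g" "\<And>x. x \<in> space M \<Longrightarrow> (norm (f x))\<^sup>2 \<le> g x"
  shows "square_integrable M f"
  unfolding square_integrable_def
  using assms by (auto intro!: Bochner_Integration.integrable_bound[OF assms(2)] AE_I2 order_trans[OF _ abs_ge_self])

lemma norm_add_squared_le: "(norm (x + y :: 'a::real_normed_vector))\<^sup>2 \<le> 2 * (norm x)\<^sup>2 + 2 * (norm y)\<^sup>2"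
proof -
  have "(norm (x + y))\<^sup>2 \<le> (norm x + norm y)\<^sup>2"
    by (intro power_mono norm_triangle_ineq) auto
  also have "\<dots> \<le> 2 * (norm x)\<^sup>2 + 2 * (norm y)\<^sup>2"
    using sum_squares_bound[of "norm x" "norm y"] by (simp add: power2_sum)
  finally show ?thesis .
qed

lemma norm_diff_squared_le: "(norm (x - y :: 'a::real_normed_vector))\<^sup>2 \<le> 2 * (norm x)\<^sup>2 + 2 * (norm y)\<^sup>2"
  using norm_add_squared_le[of x "- y"] by simp

lemma square_integrable_add:
  assumes "square_integrable M f" "square_integrable M g"
  shows "square_integrable M (\<lambda>x. f x + g x)"
  using assms
  by (intro square_integrable_bound[where g = "\<lambda>x. 2 * (norm (f x))\<^sup>2 + 2 * (norm (g x))\<^sup>2"])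
     (auto simp: norm_add_squared_le square_integrable_def)

lemma square_integrable_diff:
  assumes "square_integrable M f" "square_integrable M g"
  shows "square_integrable M (\<lambda>x. f x - g x)"
  using assms
  by (intro square_integrable_bound[where g = "\<lambda>x. 2 * (norm (f x))\<^sup>2 + 2 * (norm (g x))\<^sup>2"])
     (auto simp: norm_diff_squared_le square_integrable_def)

lemma square_integrable_cmult:
  assumes "square_integrable M f"
  shows "square_integrable M (\<lambda>x. c * f x)"
  using assms by (auto simp: square_integrable_def norm_mult power_mult_distrib)

lemma square_integrable_sum:
  assumes "\<And>i. i \<in> F \<Longrightarrow> square_integrable M (g i)"
  shows "square_integrable M (\<lambda>x. \<Sum>i\<in>F. g i x)"
  using assms
proof (induction F rule: infinite_finite_induct)
  case (insert i F)
  then show ?case by (auto intro!: square_integrable_add)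
qed (auto simp: square_integrable_def)

lemma borel_measurable_cnj [measurable (raw)]:
  "f \<in> borel_measurable M \<Longrightarrow> (\<lambda>x. cnj (f x)) \<in> borel_measurable M"
  by (rule measurable_compose[OF _ borel_measurable_continuous_onI]) (auto intro: continuous_intros)

lemma square_integrable_mult_cnj:
  assumes "square_integrable M f" "square_integrable M g"
  shows "integrable M (\<lambda>x. f x * cnj (g x))"
proof (rule Bochner_Integration.integrable_bound)
  show "integrable M (\<lambda>x. (norm (f x))\<^sup>2 + (norm (g x))\<^sup>2)"
    using assms by (simp add: square_integrable_norm)
  have "norm (f x) * norm (g x) \<le> (norm (f x))\<^sup>2 + (norm (g x))\<^sup>2" for x
    using sum_squares_bound[of "norm (f x)" "norm (g x)"]
      mult_nonneg_nonneg[OF norm_ge_zero[of "f x"] norm_ge_zero[of "g x"]]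
    by linarith
  then show "AE x in M. norm (f x * cnj (g x)) \<le> norm ((norm (f x))\<^sup>2 + (norm (g x))\<^sup>2)"
    by (auto simp: norm_mult)
qed (use assms in measurable)

lemma norm_diff_squared_complex:
  "(norm (u - v))\<^sup>2 = (norm u)\<^sup>2 - 2 * Re (u * cnj v) + (norm (v::complex))\<^sup>2"
  unfolding cmod_power2 by (simp add: power2_eq_square algebra_simps)

text \<open>Expand the square by orthonormality and complete the square in each coefficient. With
  \<open>a\<close> equal to the Fourier coefficients this gives Bessel's inequality; for general
  \<open>a\<close> it bounds the approximation error from below.\<close>

lemma orthonormal_distance:
  fixes E :: "'i \<Rightarrow> 'a \<Rightarrow> complex"
  assumes E: "\<And>i. square_integrable M (E i)"
    and orth: "\<And>i j. (LINT x|M. E i x * cnj (E j x)) = (if i = j then 1 else 0)"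
    and h: "square_integrable M h" and F: "finite F"
  shows "(LINT x|M. (norm (h x - (\<Sum>i\<in>F. a i * E i x)))\<^sup>2) =
    (LINT x|M. (norm (h x))\<^sup>2) - (\<Sum>i\<in>F. (norm (LINT x|M. h x * cnj (E i x)))\<^sup>2)
      + (\<Sum>i\<in>F. (norm ((LINT x|M. h x * cnj (E i x)) - a i))\<^sup>2)"
proof -
  define c where "c i = (LINT x|M. h x * cnj (E i x))" for i
  define g where "g = (\<lambda>x. \<Sum>i\<in>F. a i * E i x)"
  have g: "square_integrable M g"
    unfolding g_def by (intro square_integrable_sum square_integrable_cmult E)
  \<comment> \<open>Used twice: \<open>u = h\<close> gives the cross term and \<open>u = g\<close>
    the squared norm of \<open>g\<close>.\<close>
  have ip: "(LINT x|M. u x * cnj (g x)) = (\<Sum>i\<in>F. cnj (a i) * (LINT x|M. u x * cnj (E i x)))"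
    if u: "square_integrable M u" for u
  proof -
    have "(LINT x|M. u x * cnj (g x)) = (LINT x|M. (\<Sum>i\<in>F. cnj (a i) * (u x * cnj (E i x))))"
      by (intro Bochner_Integration.integral_cong) (auto simp: g_def sum_distrib_left algebra_simps)
    also have "\<dots> = (\<Sum>i\<in>F. cnj (a i) * (LINT x|M. u x * cnj (E i x)))"
      using square_integrable_mult_cnj[OF u E] by (subst Bochner_Integration.integral_sum) auto
    finally show ?thesis .
  qed
  have gg: "(LINT x|M. g x * cnj (g x)) = of_real (\<Sum>i\<in>F. (norm (a i))\<^sup>2)"
  proof -
    have "(LINT x|M. g x * cnj (E i x)) = (if i \<in> F then a i else 0)" for i
    proof -
      have "(LINT x|M. g x * cnj (E i x)) = (LINT x|M. (\<Sum>j\<in>F. a j * (E j x * cnj (E i x))))"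
        by (intro Bochner_Integration.integral_cong) (auto simp: g_def sum_distrib_right mult.assoc)
      also have "\<dots> = (\<Sum>j\<in>F. a j * (LINT x|M. E j x * cnj (E i x)))"
        using square_integrable_mult_cnj[OF E E] by (subst Bochner_Integration.integral_sum) auto
      also have "\<dots> = (if i \<in> F then a i else 0)"
        using F by (simp add: orth if_distrib sum.delta cong: if_cong)
      finally show ?thesis .
    qed
    then show ?thesis using ip[OF g] by (simp add: complex_norm_square mult.commute del: of_real_power)
  qed
  have "(LINT x|M. (norm (h x - g x))\<^sup>2) =
      (LINT x|M. (norm (h x))\<^sup>2 - 2 * Re (h x * cnj (g x)) + Re (g x * cnj (g x)))"
    unfolding norm_diff_squared_complex
    by (intro Bochner_Integration.integral_cong) (simp_all add: complex_mult_cnj cmod_power2)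
  also have "\<dots> = (LINT x|M. (norm (h x))\<^sup>2) - 2 * Re (LINT x|M. h x * cnj (g x))
      + Re (LINT x|M. g x * cnj (g x))"
    using square_integrable_mult_cnj[OF h g] square_integrable_mult_cnj[OF g g] square_integrable_norm[OF h]
    by (simp del: times_complex.sel)
  also have "\<dots> = (LINT x|M. (norm (h x))\<^sup>2) - (\<Sum>i\<in>F. (norm (c i))\<^sup>2) + (\<Sum>i\<in>F. (norm (c i - a i))\<^sup>2)"
    unfolding ip[OF h] gg c_def[symmetric] norm_diff_squared_complex
    by (simp add: sum.distrib sum_subtractf sum_distrib_left mult.commute)
  finally show ?thesis unfolding g_def c_def .
qed

text \<open>Bessel's inequality keeps all finite partial sums below the squared norm, and good
  approximations push them arbitrarily close to it. Only the given \<open>h\<close> has to be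
  approximable, so completeness of the function space is not involved.\<close>

lemma parseval_orthonormal_dense:
  fixes E :: "'i \<Rightarrow> 'a \<Rightarrow> complex"
  assumes E: "\<And>i. square_integrable M (E i)"
    and orth: "\<And>i j. (LINT x|M. E i x * cnj (E j x)) = (if i = j then 1 else 0)"
    and h: "square_integrable M h"
    and dense: "\<And>e. e > 0 \<Longrightarrow> \<exists>F a. finite F \<and> (LINT x|M. (norm (h x - (\<Sum>i\<in>F. a i * E i x)))\<^sup>2) < e"
  shows "((\<lambda>i. (norm (LINT x|M. h x * cnj (E i x)))\<^sup>2) has_sum (LINT x|M. (norm (h x))\<^sup>2)) UNIV"
proof -
  define c where "c i = (LINT x|M. h x * cnj (E i x))" for i
  define N where "N = (LINT x|M. (norm (h x))\<^sup>2)"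
  have dist: "(LINT x|M. (norm (h x - (\<Sum>i\<in>F. a i * E i x)))\<^sup>2) =
      N - (\<Sum>i\<in>F. (norm (c i))\<^sup>2) + (\<Sum>i\<in>F. (norm (c i - a i))\<^sup>2)" if "finite F" for F a
    unfolding N_def c_def by (rule orthonormal_distance[OF E orth h that])
  have le: "(\<Sum>i\<in>F. (norm (c i))\<^sup>2) \<le> N" if "finite F" for F
  proof -
    \<comment> \<open>For \<open>a = c\<close> the last sum in \<open>dist\<close> vanishes, which
      leaves Bessel's inequality.\<close>
    have "0 \<le> (LINT x|M. (norm (h x - (\<Sum>i\<in>F. c i * E i x)))\<^sup>2)" by simp
    then show ?thesis by (simp add: dist[OF that])
  qed
  have "((\<lambda>i. (norm (c i))\<^sup>2) has_sum N) UNIV"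
    unfolding has_sum_def
  proof (rule order_tendstoI)
    fix r assume "N < r"
    then show "eventually (\<lambda>F. (\<Sum>i\<in>F. (norm (c i))\<^sup>2) < r) (finite_subsets_at_top UNIV)"
      unfolding eventually_finite_subsets_at_top
      by (intro exI[of _ "{}"]) (auto dest: le)
  next
    fix r assume "r < N"
    then obtain F a where F: "finite F" "(LINT x|M. (norm (h x - (\<Sum>i\<in>F. a i * E i x)))\<^sup>2) < N - r"
      using dense[of "N - r"] by auto
    \<comment> \<open>By \<open>dist\<close>, the error of any combination over \<open>F\<close> is
      at least \<open>N\<close> minus the partial sum over \<open>F\<close>, so an error below
      \<open>N - r\<close> forces that partial sum above \<open>r\<close>.\<close>
    have "0 \<le> (\<Sum>i\<in>F. (norm (c i - a i))\<^sup>2)" by (intro sum_nonneg) auto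
    then have "r < (\<Sum>i\<in>F. (norm (c i))\<^sup>2)" using F(2) dist[OF F(1), of a] by linarith
    then show "eventually (\<lambda>F. r < (\<Sum>i\<in>F. (norm (c i))\<^sup>2)) (finite_subsets_at_top UNIV)"
      unfolding eventually_finite_subsets_at_top using F(1)
      by (intro exI[of _ F] conjI allI impI) (auto elim!: less_le_trans intro: sum_mono2)
  qed
  then show ?thesis unfolding c_def N_def .
qed

subsection \<open>Trigonometric polynomials in a monotone phase\<close>

text \<open>These are the Laurent polynomials in \<open>cis (\<theta> x)\<close>. Negative
  frequencies are allowed so that the real coordinates of \<open>cis (\<theta> x)\<close> are
  included.\<close>

definition trig_polynomial :: "('a \<Rightarrow> real) \<Rightarrow> ('a \<Rightarrow> complex) \<Rightarrow> bool" where
  "trig_polynomial \<theta> p \<longleftrightarrow>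
     (\<exists>F a. finite F \<and> p = (\<lambda>x. \<Sum>m\<in>F. a m * cis (of_int (m::int) * \<theta> x)))"

lemma trig_polynomial_cis: "trig_polynomial \<theta> (\<lambda>x. c * cis (of_int m * \<theta> x))"
  unfolding trig_polynomial_def by (intro exI[of _ "{m}"] exI[of _ "\<lambda>_. c"]) auto

lemma trig_polynomial_add:
  assumes "trig_polynomial \<theta> p" "trig_polynomial \<theta> q"
  shows "trig_polynomial \<theta> (\<lambda>x. p x + q x)"
proof -
  obtain F a where F: "finite F" "p = (\<lambda>x. \<Sum>m\<in>F. a m * cis (of_int m * \<theta> x))"
    using assms(1) unfolding trig_polynomial_def by blast
  obtain G b where G: "finite G" "q = (\<lambda>x. \<Sum>m\<in>G. b m * cis (of_int m * \<theta> x))"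
    using assms(2) unfolding trig_polynomial_def by blast
  define c where "c m = (if m \<in> F then a m else 0) + (if m \<in> G then b m else 0)" for m
  have "p x + q x = (\<Sum>m\<in>F \<union> G. c m * cis (of_int m * \<theta> x))" for x
  proof -
    have "p x = (\<Sum>m\<in>F \<union> G. (if m \<in> F then a m else 0) * cis (of_int m * \<theta> x))"
      unfolding F(2) using F(1) G(1) by (intro sum.mono_neutral_cong_left) auto
    moreover have "q x = (\<Sum>m\<in>F \<union> G. (if m \<in> G then b m else 0) * cis (of_int m * \<theta> x))"
      unfolding G(2) using F(1) G(1) by (intro sum.mono_neutral_cong_left) auto
    ultimately show ?thesis by (simp add: c_def sum.distrib distrib_right)
  qed
  then show ?thesis
    unfolding trig_polynomial_def using F(1) G(1) by (intro exI[of _ "F \<union> G"] exI[of _ c]) auto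
qed

lemma trig_polynomial_sum:
  "(\<And>i. i \<in> I \<Longrightarrow> trig_polynomial \<theta> (p i)) \<Longrightarrow> trig_polynomial \<theta> (\<lambda>x. \<Sum>i\<in>I. p i x)"
proof (induction I rule: infinite_finite_induct)
  case (insert i I)
  then show ?case by (auto intro!: trig_polynomial_add)
qed (use trig_polynomial_cis[of \<theta> 0 0] in auto)

lemma trig_polynomial_mult:
  assumes "trig_polynomial \<theta> p" "trig_polynomial \<theta> q"
  shows "trig_polynomial \<theta> (\<lambda>x. p x * q x)"
proof -
  obtain F a where F: "p = (\<lambda>x. \<Sum>m\<in>F. a m * cis (of_int m * \<theta> x))"
    using assms(1) unfolding trig_polynomial_def by blast
  obtain G b where G: "q = (\<lambda>x. \<Sum>m\<in>G. b m * cis (of_int m * \<theta> x))"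
    using assms(2) unfolding trig_polynomial_def by blast
  have "(\<lambda>x. p x * q x) = (\<lambda>x. \<Sum>m\<in>F. \<Sum>n\<in>G. (a m * b n) * cis (of_int (m + n) * \<theta> x))"
    unfolding F G of_int_add distrib_right cis_mult[symmetric] by (simp add: sum_product mult_ac)
  then show ?thesis
    by (simp only:) (intro trig_polynomial_sum trig_polynomial_cis)
qed

lemma trig_polynomial_const: "trig_polynomial \<theta> (\<lambda>x. c)"
  using trig_polynomial_cis[of \<theta> c 0] by simp

text \<open>A real-linear functional of \<open>cis t\<close> combines \<open>cos t\<close> and
  \<open>sin t\<close>, hence has frequencies 1 and -1 only; sums and products then follow from the
  closure properties.\<close>

lemma trig_polynomial_real_polynomial_function:
  fixes p :: "complex \<Rightarrow> real"
  assumes "real_polynomial_function p"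
  shows "trig_polynomial \<theta> (\<lambda>x. of_real (p (cis (\<theta> x))))"
  using assms
proof (induction p rule: real_polynomial_function.induct)
  case (linear p)
  interpret bounded_linear p by fact
  \<comment> \<open>The coefficients come from inserting Euler's formulas into
    \<open>cos t * p 1 + sin t * p \<i>\<close>.\<close>
  have "of_real (p (cis t)) = (of_real (p 1) - \<i> * of_real (p \<i>)) / 2 * cis (of_int 1 * t) +
      (of_real (p 1) + \<i> * of_real (p \<i>)) / 2 * cis (of_int (-1) * t)" for t
  proof -
    have "cis t = cos t *\<^sub>R 1 + sin t *\<^sub>R \<i>"
      by (simp add: complex_eq_iff)
    then have "p (cis t) = cos t * p 1 + sin t * p \<i>"
      by (metis add scaleR real_scaleR_def)
    then show ?thesis
      by (simp add: complex_eq_iff field_simps)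
  qed
  then show ?case
    by (simp only:) (intro trig_polynomial_add trig_polynomial_cis)
next
  case (add f g)
  then show ?case by (simp add: trig_polynomial_add)
next
  case (mult f g)
  then show ?case by (simp add: trig_polynomial_mult)
qed (rule trig_polynomial_const)

lemma trig_polynomial_polynomial_function:
  fixes p :: "complex \<Rightarrow> complex"
  assumes "polynomial_function p"
  shows "trig_polynomial \<theta> (\<lambda>x. p (cis (\<theta> x)))"
proof -
  have "real_polynomial_function (Re \<circ> p)" "real_polynomial_function (Im \<circ> p)"
    using assms bounded_linear_Re bounded_linear_Im unfolding polynomial_function_def by blast+
  then have "trig_polynomial \<theta> (\<lambda>x. of_real ((Re \<circ> p) (cis (\<theta> x))) + \<i> * of_real ((Im \<circ> p) (cis (\<theta> x))))"
    by (intro trig_polynomial_add trig_polynomial_mult trig_polynomial_const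
        trig_polynomial_real_polynomial_function)
  then show ?thesis by (simp flip: complex_eq)
qed

text \<open>Two phases with the same \<open>cis\<close> differ by a multiple of
  \<open>2 * pi\<close>, positive here by monotonicity. Since \<open>\<theta>\<close> gains exactly
  \<open>2 * pi\<close> over the whole interval, the two points must be its ends.\<close>

lemma cis_inj_on_period:
  fixes \<theta> :: "real \<Rightarrow> real"
  assumes mono: "strict_mono_on {c..d} \<theta>" and period: "\<theta> d = \<theta> c + 2 * pi"
    and xy: "x \<in> {c..d}" "y \<in> {c..d}" "x < y" and eq: "cis (\<theta> x) = cis (\<theta> y)"
  shows "x = c \<and> y = d"
proof -
  have "cis (\<theta> y - \<theta> x) = 1"
    using eq by (simp flip: cis_divide)
  then have "cos (\<theta> y - \<theta> x) = 1"
    by (simp add: complex_eq_iff)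
  then obtain n :: int where n: "\<theta> y - \<theta> x = of_int n * 2 * pi"
    using cos_one_2pi_int by blast
  have "\<theta> x < \<theta> y"
    using mono xy by (auto simp: strict_mono_on_def)
  with n have "n > 0"
    by (smt (verit) mult_nonpos_nonneg of_int_le_0_iff pi_gt_zero)
  then have "of_int n * (2 * pi) \<ge> 1 * (2 * pi)"
    by (intro mult_right_mono) auto
  with n have *: "\<theta> y - \<theta> x \<ge> 2 * pi" by simp
  have "x \<noteq> c \<Longrightarrow> \<theta> c < \<theta> x" "y \<noteq> d \<Longrightarrow> \<theta> y < \<theta> d"
    using strict_mono_onD[OF mono, of c x] strict_mono_onD[OF mono, of y d] xy by auto
  with * period show ?thesis by (cases "x = c"; cases "y = d") auto
qed

text \<open>
  Since \<open>k c = k d\<close>, the function \<open>k\<close> factors through the circle.  The graph of the factor is a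
  continuous image of \<open>{c..d}\<close>, hence closed, so the factor is continuous and Stone-Weierstrass
  applies to it.
\<close>

lemma trig_polynomial_uniform_approx:
  fixes \<theta> :: "real \<Rightarrow> real" and k :: "real \<Rightarrow> complex"
  assumes \<theta>: "continuous_on {c..d} \<theta>" "strict_mono_on {c..d} \<theta>" "\<theta> d = \<theta> c + 2 * pi"
    and k: "continuous_on {c..d} k" "k c = k d" and e: "e > 0"
  obtains p where "trig_polynomial \<theta> p" "\<And>x. x \<in> {c..d} \<Longrightarrow> norm (k x - p x) < e"
proof -
  define u where "u x = cis (\<theta> x)" for x
  define S where "S = u ` {c..d}"
  \<comment> \<open>\<open>G\<close> is the factor on the circle, defined by an arbitrary choice of
    preimage; \<open>kk\<close> below shows that the choice does not affect the value.\<close>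
  define G where "G z = k (SOME x. x \<in> {c..d} \<and> u x = z)" for z
  have u: "continuous_on {c..d} u"
    unfolding u_def by (intro continuous_intros \<theta>)
  have kk: "k x = k y" if "x \<in> {c..d}" "y \<in> {c..d}" "u x = u y" for x y
    using cis_inj_on_period[OF \<theta>(2,3), of x y] cis_inj_on_period[OF \<theta>(2,3), of y x] that k(2)
    unfolding u_def by (cases x y rule: linorder_cases) auto
  have G: "G (u x) = k x" if x: "x \<in> {c..d}" for x
  proof -
    define y where "y = (SOME y. y \<in> {c..d} \<and> u y = u x)"
    have "y \<in> {c..d} \<and> u y = u x"
      unfolding y_def by (rule someI[of _ x]) (use x in auto)
    then show ?thesis
      using kk[of y x] x unfolding G_def y_def[symmetric] by blast
  qed
  have S: "compact S"
    unfolding S_def by (intro compact_continuous_image u) auto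
  have G_cont: "continuous_on S G"
  proof (rule continuous_from_closed_graph)
    show "compact (k ` {c..d})"
      by (intro compact_continuous_image k) auto
    show "G \<in> S \<rightarrow> k ` {c..d}"
      unfolding S_def using G by auto
    have "(\<lambda>x. (x, G x)) ` S = (\<lambda>x. (u x, k x)) ` {c..d}"
      unfolding S_def image_image using G by (intro image_cong) auto
    also have "compact \<dots>"
      by (intro compact_continuous_image continuous_intros u k) auto
    finally show "closed ((\<lambda>x. (x, G x)) ` S)"
      by (rule compact_imp_closed)
  qed
  obtain g where g: "polynomial_function g" "\<And>z. z \<in> S \<Longrightarrow> norm (G z - g z) < e"
    using Stone_Weierstrass_polynomial_function[OF S G_cont e] by auto
  show ?thesis
  proof (rule that)
    show "trig_polynomial \<theta> (\<lambda>x. g (cis (\<theta> x)))"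
      by (rule trig_polynomial_polynomial_function[OF g(1)])
    show "norm (k x - g (cis (\<theta> x))) < e" if "x \<in> {c..d}" for x
      using g(2)[of "u x"] G[OF that] that unfolding S_def u_def by auto
  qed
qed

section \<open>Approximation in square mean by continuous functions vanishing at the
  endpoints\<close>

text \<open>At each point the truncation eventually equals \<open>h\<close>, and the squared norm of
  \<open>h\<close> dominates the error.\<close>

lemma square_integrable_truncation:
  assumes h: "square_integrable M h" and e: "e > 0"
  obtains n :: nat where "(LINT x|M. (norm (h x - (if norm (h x) \<le> real n then h x else 0)))\<^sup>2) < e"
proof -
  have [measurable]: "h \<in> borel_measurable M" by (rule square_integrable_measurable[OF h])
  have "(\<lambda>n::nat. LINT x|M. (norm (h x - (if norm (h x) \<le> real n then h x else 0)))\<^sup>2)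
      \<longlonglongrightarrow> (LINT x|M. 0)"
  proof (rule integral_dominated_convergence)
    show "integrable M (\<lambda>x. (norm (h x))\<^sup>2)"
      by (rule square_integrable_norm[OF h])
    show "AE x in M. (\<lambda>n::nat. (norm (h x - (if norm (h x) \<le> real n then h x else 0)))\<^sup>2) \<longlonglongrightarrow> 0"
    proof (intro AE_I2 tendsto_eventually)
      fix x
      obtain n0 :: nat where "norm (h x) \<le> real n0" using real_arch_simple by blast
      then show "\<forall>\<^sub>F n in sequentially. (norm (h x - (if norm (h x) \<le> real n then h x else 0)))\<^sup>2 = 0"
        by (intro eventually_sequentiallyI[of n0]) auto
    qed
  qed auto
  then have "\<forall>\<^sub>F n in sequentially. (LINT x|M. (norm (h x - (if norm (h x) \<le> real n then h x else 0)))\<^sup>2) < e"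
    using e by (auto intro: order_tendstoD)
  then show ?thesis
    using that eventually_happens'[OF sequentially_bot] by blast
qed

text \<open>A measurable function is an almost everywhere limit of continuous ones. Retracting these
  to the disc of radius \<open>r\<close> keeps them bounded, a cutoff makes them vanish at both
  ends, and dominated convergence on the finite interval finishes. The zero end values later provide
  the condition \<open>k c = k d\<close> for functions on the circle.\<close>

lemma bounded_approx_continuous:
  fixes t :: "real \<Rightarrow> complex"
  assumes cd: "c < d" and t: "t \<in> borel_measurable lborel" "\<And>x. norm (t x) \<le> r"
    and e: "e > 0"
  obtains k where "continuous_on {c..d} k" "k c = 0" "k d = 0"
    "(LINT x|restrict_space lborel {c..d}. (norm (t x - k x))\<^sup>2) < e"
proof -
  define M where "M = restrict_space lborel {c..d}"
  have r: "r \<ge> 0" using t(2)[of 0] norm_ge_zero order_trans by blast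
  interpret finite_measure M
    by (rule finite_measureI) (simp add: M_def emeasure_restrict_space space_restrict_space emeasure_lborel_Icc_eq)
  have "t \<in> borel_measurable lebesgue"
    using t(1) by (simp add: measurable_completion)
  then have "t measurable_on UNIV"
    by (simp add: lebesgue_measurable_imp_measurable_on)
  then obtain N g where N: "negligible N" and g: "\<And>n. continuous_on UNIV (g n)"
    and lim: "\<And>x. x \<notin> N \<Longrightarrow> (\<lambda>n. g n x) \<longlonglongrightarrow> t x"
    unfolding measurable_on_def by auto
  \<comment> \<open>The nearest-point map to the disc is continuous by convexity and fixes the
    values of \<open>t\<close>, so composing with it does not change the limit.\<close>
  define P where "P = closest_point (cball (0::complex) r)"
  have P: "continuous_on UNIV P" "norm (P z) \<le> r" "norm z \<le> r \<Longrightarrow> P z = z" for z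
    using continuous_on_closest_point[of "cball (0::complex) r" UNIV]
      closest_point_in_set[of "cball (0::complex) r" z] closest_point_self[of z "cball (0::complex) r"] r
    by (auto simp: P_def)
  \<comment> \<open>A tent of slope \<open>n\<close> capped at 1: zero at \<open>c\<close> and
    \<open>d\<close>, and equal to 1 at a given interior point once \<open>n\<close> exceeds the
    reciprocal of its distance to the nearer end.\<close>
  define cut where "cut n x = min 1 (real n * min (x - c) (d - x))" for n x
  define k where "k n x = cut n x *\<^sub>R P (g n x)" for n x
  have k_cont: "continuous_on A (k n)" for n A
    unfolding k_def cut_def
    by (intro continuous_intros continuous_on_compose2[OF P(1)] continuous_on_subset[OF g]) auto
  have k_le: "norm (k n x) \<le> r" if "x \<in> {c..d}" for n x
  proof -
    have "0 \<le> cut n x" "cut n x \<le> 1" using that by (auto simp: cut_def)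
    then show ?thesis
      unfolding k_def using mult_mono[of "cut n x" 1 "norm (P (g n x))" r] P(2) by auto
  qed
  have meas: "t \<in> borel_measurable M" "k n \<in> borel_measurable M" for n
    unfolding M_def using t(1) borel_measurable_continuous_onI[OF k_cont]
    by (auto intro!: measurable_restrict_space1)
  have k_lim: "(\<lambda>n. k n x) \<longlonglongrightarrow> t x" if x: "x \<in> {c<..<d}" "x \<notin> N" for x
  proof -
    obtain n0 :: nat where n0: "inverse (min (x - c) (d - x)) \<le> real n0"
      using real_arch_simple by blast
    have pos: "min (x - c) (d - x) > 0" using x by auto
    have "cut n x = 1" if "n \<ge> n0" for n
    proof -
      have "1 = inverse (min (x - c) (d - x)) * min (x - c) (d - x)"
        using pos by (intro left_inverse[symmetric]) linarith
      also have "\<dots> \<le> real n * min (x - c) (d - x)"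
        using n0 that pos by (intro mult_right_mono) linarith+
      finally show ?thesis by (simp add: cut_def)
    qed
    then have "(\<lambda>n. cut n x) \<longlonglongrightarrow> 1"
      by (intro tendsto_eventually eventually_sequentiallyI[of n0])
    moreover have "(\<lambda>n. P (g n x)) \<longlonglongrightarrow> P (t x)"
      using continuous_on_tendsto_compose[OF P(1) lim[OF x(2)]] by auto
    ultimately have "(\<lambda>n. k n x) \<longlonglongrightarrow> 1 *\<^sub>R P (t x)"
      unfolding k_def by (intro tendsto_intros)
    then show ?thesis using P(3)[OF t(2)] by simp
  qed
  have "(\<lambda>n. LINT x|M. (norm (t x - k n x))\<^sup>2) \<longlonglongrightarrow> (LINT x|M. 0)"
  proof (rule integral_dominated_convergence)
    show "integrable M (\<lambda>x. 4 * r\<^sup>2)" by simp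
    have "AE x in lborel. x \<notin> N"
      using N AE_not_in[of N lebesgue] by (simp add: negligible_iff_null_sets AE_completion_iff)
    \<comment> \<open>At the endpoints the cutoff is 0 for every \<open>n\<close>, so convergence
      may fail there; these two points form a null set.\<close>
    then have "AE x in lborel. x \<in> {c..d} \<longrightarrow> (\<lambda>n. (norm (t x - k n x))\<^sup>2) \<longlonglongrightarrow> 0"
      using AE_lborel_singleton[of c] AE_lborel_singleton[of d]
    proof eventually_elim
      case (elim x)
      show ?case
      proof
        assume "x \<in> {c..d}"
        then have "x \<in> {c<..<d}" using elim by auto
        then have "(\<lambda>n. (norm (t x - k n x))\<^sup>2) \<longlonglongrightarrow> (norm (t x - t x))\<^sup>2"
          using elim by (intro tendsto_intros k_lim)
        then show "(\<lambda>n. (norm (t x - k n x))\<^sup>2) \<longlonglongrightarrow> 0" by simp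
      qed
    qed
    then show "AE x in M. (\<lambda>n. (norm (t x - k n x))\<^sup>2) \<longlonglongrightarrow> 0"
      unfolding M_def by (subst AE_restrict_space_iff) auto
    show "AE x in M. norm ((norm (t x - k n x))\<^sup>2) \<le> 4 * r\<^sup>2" for n
    proof (rule AE_I2)
      fix x assume "x \<in> space M"
      then have x: "x \<in> {c..d}" by (auto simp: M_def space_restrict_space)
      have "(norm (t x - k n x))\<^sup>2 \<le> 2 * (norm (t x))\<^sup>2 + 2 * (norm (k n x))\<^sup>2"
        by (rule norm_diff_squared_le)
      also have "\<dots> \<le> 2 * r\<^sup>2 + 2 * r\<^sup>2"
        by (intro add_mono mult_left_mono power_mono t k_le x) auto
      finally show "norm ((norm (t x - k n x))\<^sup>2) \<le> 4 * r\<^sup>2" by simp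
    qed
  qed (use meas in measurable)
  then have "\<forall>\<^sub>F n in sequentially. (LINT x|M. (norm (t x - k n x))\<^sup>2) < e"
    using e by (auto intro: order_tendstoD)
  then obtain n where "(LINT x|M. (norm (t x - k n x))\<^sup>2) < e"
    using eventually_happens'[OF sequentially_bot] by blast
  moreover have "k n c = 0" "k n d = 0" using cd by (simp_all add: k_def cut_def)
  ultimately show ?thesis
    using that[of "k n"] k_cont by (simp add: M_def)
qed

text \<open>Truncate first, then approximate the bounded truncation. Both squared errors are below
  \<open>e / 4\<close>, and \<open>norm_add_squared_le\<close> doubles their sum.\<close>

lemma square_integrable_approx_continuous:
  fixes h :: "real \<Rightarrow> complex"
  assumes cd: "c < d" and h: "square_integrable (restrict_space lborel {c..d}) h" and e: "e > 0"
  obtains k where "continuous_on {c..d} k" "k c = 0" "k d = 0"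
    "square_integrable (restrict_space lborel {c..d}) k"
    "(LINT x|restrict_space lborel {c..d}. (norm (h x - k x))\<^sup>2) < e"
proof -
  define M where "M = restrict_space lborel {c..d}"
  interpret finite_measure M
    by (rule finite_measureI)
       (simp add: M_def emeasure_restrict_space space_restrict_space emeasure_lborel_Icc_eq)
  have hM: "square_integrable M h" using h by (simp add: M_def)
  then have [measurable]: "h \<in> borel_measurable M" by (rule square_integrable_measurable)
  obtain n :: nat
    where n: "(LINT x|M. (norm (h x - (if norm (h x) \<le> real n then h x else 0)))\<^sup>2) < e / 4"
    using square_integrable_truncation[OF hM, of "e / 4"] e by auto
  define t where "t x = (if norm (h x) \<le> real n then h x else 0)" for x
  \<comment> \<open>Measurability of \<open>t\<close> is known on \<open>{c..d}\<close> only;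
    extension by zero gives a Borel function on the whole line.\<close>
  define t' where "t' x = indicator {c..d} x *\<^sub>R t x" for x
  have [measurable]: "t \<in> borel_measurable M" unfolding t_def by measurable
  have "t' \<in> borel_measurable lborel"
    using \<open>t \<in> borel_measurable M\<close> unfolding M_def t'_def
    by (subst (asm) borel_measurable_restrict_space_iff) auto
  moreover have "norm (t' x) \<le> real n" for x
    by (auto simp: t'_def t_def indicator_def)
  ultimately obtain k where k: "continuous_on {c..d} k" "k c = 0" "k d = 0"
    "(LINT x|M. (norm (t' x - k x))\<^sup>2) < e / 4"
    using bounded_approx_continuous[OF cd, of t' "real n" "e / 4"] e unfolding M_def by auto
  have "(LINT x|M. (norm (t' x - k x))\<^sup>2) = (LINT x|M. (norm (t x - k x))\<^sup>2)"
    by (intro Bochner_Integration.integral_cong) (auto simp: M_def space_restrict_space t'_def)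
  with k have tk: "(LINT x|M. (norm (t x - k x))\<^sup>2) < e / 4" by simp
  obtain K where K: "\<And>x. x \<in> {c..d} \<Longrightarrow> norm (k x) \<le> K"
  proof -
    have "bounded (k ` {c..d})"
      by (intro compact_imp_bounded compact_continuous_image k) auto
    then show ?thesis using that unfolding bounded_iff by blast
  qed
  have space: "x \<in> space M \<Longrightarrow> x \<in> {c..d}" for x
    by (auto simp: M_def space_restrict_space)
  have kM: "square_integrable M k"
  proof (rule square_integrable_bound)
    show "k \<in> borel_measurable M"
      using borel_measurable_continuous_on_restrict[OF k(1)]
      by (simp add: M_def cong: measurable_cong_sets sets_restrict_space_cong)
    show "integrable M (\<lambda>x. K\<^sup>2)" by simp
    show "(norm (k x))\<^sup>2 \<le> K\<^sup>2" if "x \<in> space M" for x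
      using K[OF space[OF that]] by (intro power_mono) auto
  qed
  have tM: "square_integrable M t"
    by (rule square_integrable_bound[where g = "\<lambda>x. (norm (h x))\<^sup>2"])
       (auto simp: t_def square_integrable_norm[OF hM])
  have int: "integrable M (\<lambda>x. (norm (h x - t x))\<^sup>2)" "integrable M (\<lambda>x. (norm (t x - k x))\<^sup>2)"
    "integrable M (\<lambda>x. (norm (h x - k x))\<^sup>2)"
    by (intro square_integrable_norm square_integrable_diff hM tM kM)+
  have "(LINT x|M. (norm (h x - k x))\<^sup>2)
      \<le> (LINT x|M. 2 * (norm (h x - t x))\<^sup>2 + 2 * (norm (t x - k x))\<^sup>2)"
  proof (rule integral_mono)
    show "(norm (h x - k x))\<^sup>2 \<le> 2 * (norm (h x - t x))\<^sup>2 + 2 * (norm (t x - k x))\<^sup>2" for x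
      using norm_add_squared_le[of "h x - t x" "t x - k x"] by simp
  qed (use int in simp_all)
  also have "\<dots> = 2 * (LINT x|M. (norm (h x - t x))\<^sup>2) + 2 * (LINT x|M. (norm (t x - k x))\<^sup>2)"
    using int by simp
  also have "\<dots> < e"
    using n tk unfolding t_def by linarith
  finally show ?thesis
    using that[of k] k kM unfolding M_def by blast
qed

section \<open>Orthogonality and completeness for a monotone phase\<close>

text \<open>This is the substitution \<open>t = \<theta> x\<close> in the integral of
  \<open>cis (m * t)\<close> over one period, carried out with explicit antiderivatives.\<close>

lemma integral_deriv_cis:
  fixes \<theta> \<theta>' :: "real \<Rightarrow> real"
  assumes cd: "c < d"
    and deriv: "\<And>x. x \<in> {c..d} \<Longrightarrow> (\<theta> has_real_derivative \<theta>' x) (at x)"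
    and cont: "continuous_on {c..d} \<theta>'"
    and period: "\<theta> d = \<theta> c + 2 * pi"
  shows "(LINT x|restrict_space lborel {c..d}. of_real (\<theta>' x) * cis (of_int m * \<theta> x)) =
    (if m = 0 then 2 * pi else 0)"
proof (cases "m = 0")
  case True
  have "(LBINT x. indicator {c..d} x *\<^sub>R \<theta>' x) = \<theta> d - \<theta> c"
    using cd cont deriv
    by (intro integral_FTC_Icc)
       (auto simp flip: has_real_derivative_iff_has_vector_derivative intro: has_field_derivative_at_within)
  then show ?thesis
    using True period by (simp add: integral_restrict_space flip: of_real_mult)
next
  case False
  have \<theta>: "continuous_on {c..d} \<theta>"
    using deriv by (meson DERIV_isCont continuous_at_imp_continuous_on)
  define F where "F x = cis (of_int m * \<theta> x) * (1 / (\<i> * of_int m))" for x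
  have "(LBINT x. indicator {c..d} x *\<^sub>R (of_real (\<theta>' x) * cis (of_int m * \<theta> x))) = F d - F c"
  proof (rule integral_FTC_Icc)
    show "(F has_vector_derivative of_real (\<theta>' x) * cis (of_int m * \<theta> x)) (at x within {c..d})"
      if "c \<le> x" "x \<le> d" for x
    proof -
      have "(\<theta> has_derivative (\<lambda>t. t * \<theta>' x)) (at x within {c..d})"
        using has_field_derivative_at_within[OF deriv] that
        by (auto simp: has_field_derivative_def mult_commute_abs)
      then have "((\<lambda>y. of_int m * \<theta> y) has_derivative (\<lambda>t. of_int m * (t * \<theta>' x))) (at x within {c..d})"
        by (intro derivative_intros)
      then have "(F has_derivative (\<lambda>t. (of_int m * (t * \<theta>' x)) *\<^sub>R (\<i> * cis (of_int m * \<theta> x)) *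
          (1 / (\<i> * of_int m)))) (at x within {c..d})"
        unfolding F_def by (intro has_derivative_mult_left has_derivative_cis)
      then show ?thesis
        unfolding has_vector_derivative_def
        by (rule has_derivative_eq_rhs) (use False in \<open>auto simp: field_simps scaleR_conv_of_real\<close>)
    qed
    show "continuous_on {c..d} (\<lambda>x. of_real (\<theta>' x) * cis (of_int m * \<theta> x))"
      by (intro continuous_intros cont \<theta>)
  qed (use cd in auto)
  moreover have "cis (of_int m * (2 * pi)) = 1"
    using cis_multiple_2pi[of "of_int m"] by (simp add: mult.commute mult.left_commute)
  then have "F d = F c"
    by (simp add: F_def period distrib_left flip: cis_mult)
  ultimately show ?thesis
    using False by (simp add: integral_restrict_space)
qed

text \<open>The system is the pullback of the Fourier basis along \<open>\<theta>\<close>, with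
  \<open>w\<close> the square root of the Jacobian. For completeness, approximate \<open>h\<close>
  by a continuous \<open>k\<close> vanishing at the ends, then \<open>k / w\<close> uniformly by a
  trigonometric polynomial. The factor \<open>2 * pi\<close> appears because the vectors are not
  normalized.\<close>

theorem parseval_cis_interval:
  fixes \<theta> w :: "real \<Rightarrow> real" and h :: "real \<Rightarrow> complex"
  assumes cd: "c < d"
    and deriv: "\<And>x. x \<in> {c..d} \<Longrightarrow> (\<theta> has_real_derivative (w x)\<^sup>2) (at x)"
    and w: "continuous_on {c..d} w" "\<And>x. x \<in> {c..d} \<Longrightarrow> w x > 0"
    and period: "\<theta> d = \<theta> c + 2 * pi"
    and h: "square_integrable (restrict_space lborel {c..d}) h"
  shows "((\<lambda>m::int. (norm (LINT x|restrict_space lborel {c..d}.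
              h x * cnj (of_real (w x) * cis (of_int m * \<theta> x))))\<^sup>2)
            has_sum 2 * pi * (LINT x|restrict_space lborel {c..d}. (norm (h x))\<^sup>2)) UNIV"
proof -
  define M where "M = restrict_space lborel {c..d}"
  interpret finite_measure M
    by (rule finite_measureI)
       (simp add: M_def emeasure_restrict_space space_restrict_space emeasure_lborel_Icc_eq)
  have space: "x \<in> space M \<Longrightarrow> x \<in> {c..d}" for x
    by (auto simp: M_def space_restrict_space)
  have measM: "measure M (space M) = d - c"
    using cd by (simp add: M_def space_restrict_space measure_restrict_space)
  have \<theta>: "continuous_on {c..d} \<theta>"
    using deriv by (meson DERIV_isCont continuous_at_imp_continuous_on)
  have mono: "strict_mono_on {c..d} \<theta>"
  proof (rule strict_mono_onI)
    fix x y assume xy: "x \<in> {c..d}" "y \<in> {c..d}" "x < y"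
    show "\<theta> x < \<theta> y"
    proof (rule DERIV_pos_imp_increasing[OF xy(3)])
      fix z assume "x \<le> z" "z \<le> y"
      then have "z \<in> {c..d}" using xy by auto
      then show "\<exists>r. (\<theta> has_real_derivative r) (at z) \<and> 0 < r"
        using deriv[of z] w(2)[of z] by (intro exI[of _ "(w z)\<^sup>2"]) auto
    qed
  qed
  have meas: "g \<in> borel_measurable M" if "continuous_on {c..d} g" for g :: "real \<Rightarrow> complex"
    using borel_measurable_continuous_on_restrict[OF that]
    by (simp add: M_def cong: measurable_cong_sets sets_restrict_space_cong)
  obtain W where W: "W > 0" "\<And>x. x \<in> {c..d} \<Longrightarrow> w x \<le> W"
  proof -
    have "bounded (w ` {c..d})"
      by (intro compact_imp_bounded compact_continuous_image w) auto
    then obtain b where "b > 0" "\<And>x. x \<in> {c..d} \<Longrightarrow> \<bar>w x\<bar> \<le> b"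
      unfolding bounded_pos by auto
    then show ?thesis using that[of b] by force
  qed
  define C where "C = 1 / sqrt (2 * pi)"
  have C: "C > 0" "C\<^sup>2 = 1 / (2 * pi)" by (auto simp: C_def power_divide)
  define E where "E m x = of_real (C * w x) * cis (of_int m * \<theta> x)" for m :: int and x
  have E_cont: "continuous_on {c..d} (E m)" for m
    unfolding E_def by (intro continuous_intros w \<theta>)
  have E: "square_integrable M (E m)" for m
  proof (rule square_integrable_bound)
    show "integrable M (\<lambda>x. (C * W)\<^sup>2)" by simp
    show "(norm (E m x))\<^sup>2 \<le> (C * W)\<^sup>2" if "x \<in> space M" for x
      using W(2)[OF space[OF that]] w(2)[OF space[OF that]] C(1)
      by (auto simp: E_def norm_mult intro!: power_mono)
  qed (intro meas E_cont)
  have orth: "(LINT x|M. E i x * cnj (E j x)) = (if i = j then 1 else 0)" for i j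
  proof -
    have "E i x * cnj (E j x) = of_real (C\<^sup>2) * (of_real ((w x)\<^sup>2) * cis (of_int (i - j) * \<theta> x))" for x
      unfolding E_def of_int_diff left_diff_distrib cis_divide[symmetric]
      by (simp add: cis_cnj divide_inverse power2_eq_square)
    then have "(LINT x|M. E i x * cnj (E j x)) =
        of_real (C\<^sup>2) * (LINT x|M. of_real ((w x)\<^sup>2) * cis (of_int (i - j) * \<theta> x))"
      by simp
    also have "(LINT x|M. of_real ((w x)\<^sup>2) * cis (of_int (i - j) * \<theta> x)) =
        (if i - j = 0 then 2 * pi else 0)"
      unfolding M_def by (rule integral_deriv_cis[OF cd deriv _ period]) (auto intro!: continuous_intros w)
    finally show ?thesis by (simp add: C(2))
  qed
  have hM: "square_integrable M h" using h by (simp add: M_def)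
  have dense: "\<exists>F a. finite F \<and> (LINT x|M. (norm (h x - (\<Sum>m\<in>F. a m * E m x)))\<^sup>2) < e" if e: "e > 0" for e
  proof -
    obtain k where k: "continuous_on {c..d} k" "k c = 0" "k d = 0" "square_integrable M k"
      "(LINT x|M. (norm (h x - k x))\<^sup>2) < e / 4"
      using square_integrable_approx_continuous[OF cd h, of "e / 4"] e unfolding M_def by auto
    \<comment> \<open>Chosen so that a uniform error \<open>W * \<delta>\<close> has squared mean
      \<open>e / 8\<close> over the interval; the total error is then below
      \<open>2 * (e / 4) + 2 * (e / 8) < e\<close>.\<close>
    define \<delta> where "\<delta> = sqrt (e / 8 / (d - c)) / W"
    have "W * \<delta> = sqrt (e / 8 / (d - c))"
      using W(1) by (simp add: \<delta>_def)
    then have "(W * \<delta>)\<^sup>2 = e / 8 / (d - c)"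
      using e cd by simp
    then have \<delta>: "\<delta> > 0" "(W * \<delta>)\<^sup>2 * (d - c) = e / 8"
      using e cd W(1) by (simp_all add: \<delta>_def del: divide_divide_eq_left)
    have "continuous_on {c..d} (\<lambda>x. k x / of_real (w x))"
      using w(2) by (intro continuous_intros k w) force
    then obtain p where "trig_polynomial \<theta> p"
      and p: "\<And>x. x \<in> {c..d} \<Longrightarrow> norm (k x / of_real (w x) - p x) < \<delta>"
      using trig_polynomial_uniform_approx[OF \<theta> mono period, of "\<lambda>x. k x / of_real (w x)" \<delta>]
        \<delta>(1) k(2,3) by auto
    then obtain F a where F: "finite F" "p = (\<lambda>x. \<Sum>m\<in>F. a m * cis (of_int m * \<theta> x))"
      unfolding trig_polynomial_def by blast
    \<comment> \<open>Dividing by \<open>C\<close> undoes the normalization in \<open>E\<close>, so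
      that \<open>g\<close> is \<open>w\<close> times the trigonometric polynomial
      \<open>p\<close>.\<close>
    define g where "g x = (\<Sum>m\<in>F. (a m / of_real C) * E m x)" for x
    have g: "square_integrable M g"
      unfolding g_def by (intro square_integrable_sum square_integrable_cmult E)
    have gp: "g x = of_real (w x) * p x" for x
      using C(1) by (simp add: g_def F(2) E_def sum_distrib_left mult_ac)
    have kg: "(norm (k x - g x))\<^sup>2 \<le> (W * \<delta>)\<^sup>2" if x: "x \<in> {c..d}" for x
    proof -
      have "k x - g x = of_real (w x) * (k x / of_real (w x) - p x)"
        using w(2)[OF x] by (simp add: gp right_diff_distrib)
      then have "norm (k x - g x) = w x * norm (k x / of_real (w x) - p x)"
        using w(2)[OF x] by (simp add: norm_mult del: of_real_mult)
      also have "\<dots> \<le> W * \<delta>"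
        using W(1) W(2)[OF x] w(2)[OF x] p[OF x] by (intro mult_mono) auto
      finally show ?thesis by (intro power_mono) auto
    qed
    have int: "integrable M (\<lambda>x. (norm (h x - k x))\<^sup>2)" "integrable M (\<lambda>x. (norm (h x - g x))\<^sup>2)"
      by (intro square_integrable_norm square_integrable_diff hM k g)+
    have "(LINT x|M. (norm (h x - g x))\<^sup>2) \<le> (LINT x|M. 2 * (norm (h x - k x))\<^sup>2 + 2 * (W * \<delta>)\<^sup>2)"
    proof (rule integral_mono)
      show "(norm (h x - g x))\<^sup>2 \<le> 2 * (norm (h x - k x))\<^sup>2 + 2 * (W * \<delta>)\<^sup>2" if "x \<in> space M" for x
        using norm_add_squared_le[of "h x - k x" "k x - g x"] kg[OF space[OF that]] by simp
    qed (use int in simp_all)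
    also have "\<dots> = 2 * (LINT x|M. (norm (h x - k x))\<^sup>2) + 2 * ((W * \<delta>)\<^sup>2 * (d - c))"
      using int by (simp add: measM)
    also have "\<dots> < e"
      using k(5) e unfolding \<delta>(2) by linarith
    finally show ?thesis
      unfolding g_def using F(1) by (intro exI[of _ F] exI[of _ "\<lambda>m. a m / of_real C"]) simp
  qed
  have "((\<lambda>m. (norm (LINT x|M. h x * cnj (E m x)))\<^sup>2) has_sum (LINT x|M. (norm (h x))\<^sup>2)) UNIV"
    by (rule parseval_orthonormal_dense[OF E orth hM dense])
  then have "((\<lambda>m. 2 * pi * (norm (LINT x|M. h x * cnj (E m x)))\<^sup>2)
      has_sum 2 * pi * (LINT x|M. (norm (h x))\<^sup>2)) UNIV"
    by (rule has_sum_cmult_right)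
  moreover have "2 * pi * (norm (LINT x|M. h x * cnj (E m x)))\<^sup>2 =
      (norm (LINT x|M. h x * cnj (of_real (w x) * cis (of_int m * \<theta> x))))\<^sup>2" for m
  proof -
    have "(LINT x|M. h x * cnj (E m x)) =
        (LINT x|M. of_real C * (h x * cnj (of_real (w x) * cis (of_int m * \<theta> x))))"
      by (intro Bochner_Integration.integral_cong) (auto simp: E_def)
    also have "\<dots> = of_real C * (LINT x|M. h x * cnj (of_real (w x) * cis (of_int m * \<theta> x)))"
      by (rule integral_mult_right_zero)
    finally show ?thesis by (simp add: norm_mult power_mult_distrib C(2))
  qed
  ultimately show ?thesis unfolding M_def by simp
qed

subsection \<open>Windowed systems\<close>

text \<open>Enumerate the integers and apply dominated convergence: by nonnegativity
  \<open>S\<close> itself dominates the partial sums, and the resulting series has an unordered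
  sum.\<close>

lemma has_sum_int_integral:
  fixes g :: "int \<Rightarrow> 'a \<Rightarrow> real"
  assumes int: "\<And>n. integrable M (g n)" and nonneg: "\<And>n x. g n x \<ge> 0"
    and sum: "\<And>x. ((\<lambda>n. g n x) has_sum S x) UNIV" and S: "integrable M S"
  shows "((\<lambda>n. LINT x|M. g n x) has_sum (LINT x|M. S x)) UNIV"
proof -
  have bij: "bij_betw int_decode UNIV UNIV"
    by (rule bij_int_decode)
  have sums: "(\<lambda>i. g (int_decode i) x) sums S x" for x
    using sum[of x] has_sum_reindex_bij_betw[OF bij, of "\<lambda>n. g n x"] by (auto intro: has_sum_imp_sums)
  have meas: "g n \<in> borel_measurable M" "S \<in> borel_measurable M" for n
    using int S by auto
  have "(\<lambda>N. LINT x|M. (\<Sum>i<N. g (int_decode i) x)) \<longlonglongrightarrow> (LINT x|M. S x)"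
  proof (rule integral_dominated_convergence)
    show "AE x in M. (\<lambda>N. \<Sum>i<N. g (int_decode i) x) \<longlonglongrightarrow> S x"
      using sums by (simp add: sums_def)
    show "AE x in M. norm (\<Sum>i<N. g (int_decode i) x) \<le> S x" for N
    proof (rule AE_I2)
      fix x
      have "(\<Sum>i<N. g (int_decode i) x) \<le> (\<Sum>i. g (int_decode i) x)"
        using sums[of x] nonneg by (intro sum_le_suminf) (auto simp: sums_iff)
      then show "norm (\<Sum>i<N. g (int_decode i) x) \<le> S x"
        using sums[of x] nonneg by (simp add: sums_iff sum_nonneg)
    qed
  qed (use S meas in auto)
  then have "(\<lambda>i. LINT x|M. g (int_decode i) x) sums (LINT x|M. S x)"
    using int by (simp add: sums_def)
  then have "((\<lambda>i. LINT x|M. g (int_decode i) x) has_sum (LINT x|M. S x)) UNIV"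
    using nonneg by (intro sums_nonneg_imp_has_sum) auto
  then show ?thesis
    using has_sum_reindex_bij_betw[OF bij, of "\<lambda>n. LINT x|M. g n x"] by simp
qed

text \<open>Tonelli's theorem for unordered sums.\<close>

lemma has_sum_Times_nonneg:
  fixes f :: "'a \<Rightarrow> 'b \<Rightarrow> real"
  assumes "\<And>x. ((\<lambda>y. f x y) has_sum g x) UNIV" "(g has_sum S) UNIV" "\<And>x y. f x y \<ge> 0"
  shows "((\<lambda>(x, y). f x y) has_sum S) UNIV"
proof -
  have "(\<lambda>(x, y). f x y) summable_on UNIV \<times> UNIV"
    by (rule summable_on_SigmaI[where g = g]) (use assms in \<open>auto simp: has_sum_imp_summable\<close>)
  then have "((\<lambda>(x, y). f x y) has_sum S) (UNIV \<times> UNIV)"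
    by (intro has_sum_SigmaI[where g = g]) (use assms in auto)
  then show ?thesis by simp
qed

lemma L2_iff_square_integrable: "f \<in> L2 \<longleftrightarrow> square_integrable lborel f"
  by (simp add: L2_def square_integrable_def)

text \<open>The common form of both families. For fixed \<open>n\<close>, translation moves the
  window into \<open>{c..d}\<close>, where Parseval evaluates the sum over \<open>m\<close>; the sum
  over \<open>n\<close> is then taken under the integral, where the tiling condition produces
  \<open>\<kappa>\<close>. The factor \<open>u\<close> collects phases and constants independent of
  \<open>x\<close>.\<close>

lemma windowed_frame_has_sum:
  fixes \<theta> w :: "real \<Rightarrow> real" and f \<psi> :: "real \<Rightarrow> complex" and s :: "int \<Rightarrow> int \<Rightarrow> real \<Rightarrow> complex"
  assumes cd: "c < d"
    and deriv: "\<And>x. (\<theta> has_real_derivative (w x)\<^sup>2) (at x)"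
    and w: "continuous_on UNIV w" "\<And>x. w x > 0"
    and period: "\<theta> d = \<theta> c + 2 * pi"
    and f: "f \<in> L2" and \<psi>: "\<psi> \<in> borel_measurable lborel"
    and supp: "AE x in lborel. x \<notin> {c..d} \<longrightarrow> \<psi> x = 0"
    and tiling: "\<And>x. ((\<lambda>n::int. (norm (\<psi> (x + of_int n * q)))\<^sup>2) has_sum \<kappa>) UNIV"
    and u: "\<And>n m. (norm (u n m))\<^sup>2 = r"
    and s: "\<And>n m x. s n m x = u n m * (of_real (w (x + of_int n * q)) *
              cis (of_int m * \<theta> (x + of_int n * q)) * \<psi> (x + of_int n * q))"
  shows "((\<lambda>(n, m). (norm (braket f (s n m)))\<^sup>2) has_sum
           r * (2 * pi * (\<kappa> * (LINT x|lborel. (norm (f x))\<^sup>2)))) UNIV"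
proof -
  have fsq: "square_integrable lborel f" using f by (simp add: L2_iff_square_integrable)
  then have f_meas [measurable]: "f \<in> borel_measurable borel"
    using square_integrable_measurable[OF fsq] by simp
  have [measurable]: "\<psi> \<in> borel_measurable borel" "w \<in> borel_measurable borel" "\<theta> \<in> borel_measurable borel"
    using \<psi> w(1) deriv
    by (auto intro!: borel_measurable_continuous_onI continuous_at_imp_continuous_on DERIV_isCont)
  have cis_meas [measurable]: "cis \<in> borel_measurable borel"
    by (intro borel_measurable_continuous_onI continuous_intros)
  \<comment> \<open>A single term of the tiling sum is at most \<open>\<kappa>\<close>. Thus
    \<open>\<psi>\<close> is bounded, and its product with a translate of \<open>f\<close> is square
    integrable.\<close>
  have \<psi>_le: "(norm (\<psi> x))\<^sup>2 \<le> \<kappa>" for x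
    using has_sum_mono_neutral[OF has_sum_finite[of "{0}"] tiling[of x],
        of "\<lambda>n. (norm (\<psi> (x + of_int n * q)))\<^sup>2"] by simp
  define M where "M = restrict_space lborel {c..d}"
  have to_M: "(LINT x|M. g x) = (LINT x|lborel. g x)"
    if "g \<in> borel_measurable borel" "\<And>x. \<psi> x = 0 \<Longrightarrow> g x = 0"
    for g :: "real \<Rightarrow> 'x::{banach, second_countable_topology}"
  proof -
    have "(LINT x|M. g x) = (LINT x|lborel. indicator {c..d} x *\<^sub>R g x)"
      by (simp add: M_def integral_restrict_space)
    also have "\<dots> = (LINT x|lborel. g x)"
      using supp that by (intro integral_cong_AE) (auto elim!: eventually_mono simp: indicator_def)
    finally show ?thesis .
  qed
  have shift: "(LINT x|lborel. g (x + of_int n * q)) = (LINT x|lborel. g x)"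
    for g :: "real \<Rightarrow> 'x::{banach, second_countable_topology}" and n :: int
    using lborel_integral_real_affine[of 1 g "of_int n * q"] by (simp add: add.commute)
  have shift_int: "integrable lborel (\<lambda>x. g (x + t)) \<longleftrightarrow> integrable lborel g"
    for g :: "real \<Rightarrow> real" and t :: real
    using lborel_integrable_real_affine_iff[of 1 g t] by (simp add: add.commute)
  define h where "h n y = f (y - of_int n * q) * cnj (\<psi> y)" for n :: int and y
  have h_meas [measurable]: "h n \<in> borel_measurable borel" for n
    unfolding h_def by measurable
  have h_int: "integrable lborel (\<lambda>y. (norm (h n y))\<^sup>2)" for n
  proof (rule Bochner_Integration.integrable_bound)
    have "integrable lborel (\<lambda>y. (norm (f (y + (- of_int n * q))))\<^sup>2)"
      using shift_int[of "\<lambda>y. (norm (f y))\<^sup>2" "- of_int n * q"] square_integrable_norm[OF fsq] by blast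
    then show "integrable lborel (\<lambda>y. (norm (f (y - of_int n * q)))\<^sup>2 * \<kappa>)" by simp
    have "(norm (h n y))\<^sup>2 \<le> (norm (f (y - of_int n * q)))\<^sup>2 * \<kappa>" for y
      using \<psi>_le by (auto simp: h_def norm_mult power_mult_distrib intro!: mult_left_mono)
    then show "AE y in lborel. norm ((norm (h n y))\<^sup>2) \<le> norm ((norm (f (y - of_int n * q)))\<^sup>2 * \<kappa>)"
      by (intro AE_I2) (auto intro: order_trans[OF _ abs_ge_self])
  qed simp
  have hM: "square_integrable M (h n)" for n
    unfolding square_integrable_def M_def
    using integrable_mult_indicator[OF _ h_int[of n], of "{c..d}"] h_meas[of n]
    by (simp add: integrable_restrict_space measurable_restrict_space1)
  \<comment> \<open>Since \<open>braket\<close> conjugates \<open>f\<close> whereas \<open>h\<close>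
    contains \<open>f\<close> itself, the bracket is \<open>u n m\<close> times the conjugate of the
    coefficient; the modulus is unaffected.\<close>
  have coeff: "(norm (braket f (s n m)))\<^sup>2 =
      r * (norm (LINT y|M. h n y * cnj (of_real (w y) * cis (of_int m * \<theta> y))))\<^sup>2" for n m
  proof -
    define g where "g y = h n y * cnj (of_real (w y) * cis (of_int m * \<theta> y))" for y
    have g_meas: "g \<in> borel_measurable borel"
      unfolding g_def by measurable
    have "braket f (s n m) = (LINT x|lborel. u n m * cnj (g (x + of_int n * q)))"
      unfolding braket_def by (intro Bochner_Integration.integral_cong) (auto simp: s g_def h_def)
    also have "\<dots> = u n m * cnj (LINT x|lborel. g x)"
      using shift[of g n] by simp
    also have "(LINT x|lborel. g x) = (LINT x|M. g x)"
      using g_meas by (intro to_M[symmetric]) (auto simp: g_def h_def)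
    finally show ?thesis
      by (simp add: norm_mult power_mult_distrib u g_def)
  qed
  have inner: "((\<lambda>m. (norm (braket f (s n m)))\<^sup>2) has_sum
      r * (2 * pi * (LINT x|lborel. (norm (f x))\<^sup>2 * (norm (\<psi> (x + of_int n * q)))\<^sup>2))) UNIV" for n
  proof -
    have "((\<lambda>m::int. (norm (LINT y|M. h n y * cnj (of_real (w y) * cis (of_int m * \<theta> y))))\<^sup>2)
        has_sum 2 * pi * (LINT y|M. (norm (h n y))\<^sup>2)) UNIV"
      using parseval_cis_interval[OF cd deriv continuous_on_subset[OF w(1)] w(2) period] hM
      by (simp add: M_def)
    moreover have "(LINT y|M. (norm (h n y))\<^sup>2) = (LINT y|lborel. (norm (h n y))\<^sup>2)"
      by (intro to_M) (auto simp: h_def)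
    moreover have "(LINT y|lborel. (norm (h n y))\<^sup>2) =
        (LINT x|lborel. (norm (f x))\<^sup>2 * (norm (\<psi> (x + of_int n * q)))\<^sup>2)"
      using shift[of "\<lambda>y. (norm (h n y))\<^sup>2" n] by (simp add: h_def norm_mult power_mult_distrib)
    ultimately show ?thesis
      unfolding coeff by (auto intro: has_sum_cmult_right)
  qed
  have outer: "((\<lambda>n. LINT x|lborel. (norm (f x))\<^sup>2 * (norm (\<psi> (x + of_int n * q)))\<^sup>2) has_sum
      (LINT x|lborel. (norm (f x))\<^sup>2 * \<kappa>)) UNIV"
  proof (rule has_sum_int_integral)
    show "integrable lborel (\<lambda>x. (norm (f x))\<^sup>2 * (norm (\<psi> (x + of_int n * q)))\<^sup>2)" for n
      using h_int[of n] shift_int[of "\<lambda>y. (norm (h n y))\<^sup>2" "of_int n * q"]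
      by (simp add: h_def norm_mult power_mult_distrib)
    show "((\<lambda>n. (norm (f x))\<^sup>2 * (norm (\<psi> (x + of_int n * q)))\<^sup>2) has_sum (norm (f x))\<^sup>2 * \<kappa>) UNIV" for x
      by (intro has_sum_cmult_right tiling)
  qed (use square_integrable_norm[OF fsq] in auto)
  then have "((\<lambda>n. r * (2 * pi * (LINT x|lborel. (norm (f x))\<^sup>2 * (norm (\<psi> (x + of_int n * q)))\<^sup>2)))
      has_sum r * (2 * pi * (\<kappa> * (LINT x|lborel. (norm (f x))\<^sup>2)))) UNIV"
    by (auto intro!: has_sum_cmult_right simp: mult.commute)
  with inner show ?thesis
    by (rule has_sum_Times_nonneg) auto
qed

section \<open>The affine and Heisenberg families and the limit\<close>

lemma aff_state_has_sum:
  assumes \<epsilon>: "\<epsilon> > 0" and b: "b \<noteq> 0" and L: "L > 0" and f: "f \<in> L2" and \<psi>: "\<psi> \<in> L2"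
    and supp: "AE x in lborel. x \<notin> {-L..L} \<longrightarrow> \<psi> x = 0"
    and tiling: "\<And>x. ((\<lambda>n::int. (norm (\<psi> (x + of_int n * q0)))\<^sup>2) has_sum \<kappa>) UNIV"
  shows "((\<lambda>(n, m). (norm (braket f (aff_state \<epsilon> a b L q0 \<psi> n m)))\<^sup>2) has_sum
           (exp (\<epsilon> * L) - exp (- \<epsilon> * L)) / \<epsilon> * (\<kappa> * (LINT x|lborel. (norm (f x))\<^sup>2))) UNIV"
proof -
  define D where "D = exp (\<epsilon> * L) - exp (- \<epsilon> * L)"
  have D: "D > 0" unfolding D_def using \<epsilon> L by simp
  \<comment> \<open>This constant makes \<open>w = K * aff_Q \<epsilon>\<close> a square root of the
    derivative of the phase \<open>\<theta>\<close> below.\<close>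
  define K where "K = sqrt (2 * pi * \<epsilon> / D)"
  have K: "K > 0" "K\<^sup>2 = 2 * pi * \<epsilon> / D" using D \<epsilon> by (auto simp: K_def)
  define w where "w x = K * exp (- (1 / 2) * \<epsilon> * x)" for x
  define \<theta> where "\<theta> x = - (2 * pi / D) * exp (- \<epsilon> * x)" for x
  \<comment> \<open>The factor \<open>1 / K\<close> turns \<open>w\<close> back into
    \<open>aff_Q \<epsilon>\<close>; the \<open>aff_gamma\<close> phase is constant in
    \<open>x\<close>.\<close>
  define u where "u n m = complex_of_real (1 / K) * cis (a * aff_gamma \<epsilon> b L q0 n m)" for n m
  have "((\<lambda>(n, m). (norm (braket f (aff_state \<epsilon> a b L q0 \<psi> n m)))\<^sup>2) has_sum
      D / (2 * pi * \<epsilon>) * (2 * pi * (\<kappa> * (LINT x|lborel. (norm (f x))\<^sup>2)))) UNIV"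
  proof (rule windowed_frame_has_sum[where c = "- L" and d = L and \<theta> = \<theta> and w = w and q = q0 and u = u])
    have "(w x)\<^sup>2 = 2 * pi * \<epsilon> / D * exp (- \<epsilon> * x)" for x
      by (simp add: w_def power_mult_distrib K(2) flip: exp_double)
    then show "(\<theta> has_real_derivative (w x)\<^sup>2) (at x)" for x
      unfolding \<theta>_def using D by (auto intro!: derivative_eq_intros)
    show "continuous_on UNIV w"
      unfolding w_def by (intro continuous_intros)
    show "w x > 0" for x
      using K(1) by (simp add: w_def)
    have "\<theta> L - \<theta> (- L) = 2 * pi / D * (exp (\<epsilon> * L) - exp (- \<epsilon> * L))"
      unfolding \<theta>_def right_diff_distrib by simp
    also have "\<dots> = 2 * pi"
      unfolding D_def[symmetric] using D by simp
    finally show "\<theta> L = \<theta> (- L) + 2 * pi"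
      by simp
    show "(norm (u n m))\<^sup>2 = D / (2 * pi * \<epsilon>)" for n m
      using K by (simp add: u_def norm_mult norm_divide power_mult_distrib power_divide)
    show "aff_state \<epsilon> a b L q0 \<psi> n m x = u n m * (of_real (w (x + of_int n * q0)) *
        cis (of_int m * \<theta> (x + of_int n * q0)) * \<psi> (x + of_int n * q0))" for n m x
    proof -
      have arg: "x - ln (aff_alpha \<epsilon> q0 n) / \<epsilon> = x + of_int n * q0"
        using \<epsilon> by (simp add: aff_alpha_def)
      \<comment> \<open>The factor \<open>exp (- \<epsilon> * n * q0)\<close> in
        \<open>aff_beta\<close> translates the exponential phase by \<open>n * q0\<close>, in step
        with the window; the \<open>b\<close> in its denominator cancels the \<open>b\<close> of the
        representation.\<close>
      have "exp (- \<epsilon> * (x + of_int n * q0)) = exp (- \<epsilon> * of_int n * q0) * exp (- \<epsilon> * x)"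
        by (simp add: algebra_simps flip: exp_add)
      then have phase: "b * aff_beta \<epsilon> b L q0 n m * exp (- \<epsilon> * x) = of_int m * \<theta> (x + of_int n * q0)"
        using b D unfolding aff_beta_def \<theta>_def D_def[symmetric] by (simp add: field_simps)
      have "aff_Q \<epsilon> y = w y / K" for y
        using K(1) by (simp add: aff_Q_def w_def)
      then show ?thesis
        unfolding aff_state_def aff_rep.simps arg phase u_def by simp
    qed
  qed (use L f \<psi> supp tiling in \<open>auto simp: L2_def\<close>)
  then show ?thesis using \<epsilon> by (simp add: D_def)
qed

text \<open>The choice of \<open>p0\<close> gives \<open>A * p0 = pi / L\<close>, so the modulations
  are the Fourier modes of an interval of length \<open>2 * L\<close>, and the weight is
  constant.\<close>

lemma heis_state_has_sum:
  assumes A: "A \<noteq> 0" and L: "L > 0" and p0: "p0 = pi / (A * L)" and f: "f \<in> L2" and \<psi>: "\<psi> \<in> L2"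
    and supp: "AE x in lborel. x \<notin> {-L..L} \<longrightarrow> \<psi> x = 0"
    and tiling: "\<And>x. ((\<lambda>n::int. (norm (\<psi> (x + of_int n * q0)))\<^sup>2) has_sum \<kappa>) UNIV"
  shows "((\<lambda>(n, m). (norm (braket f (heis_state A B q0 p0 \<psi> n m)))\<^sup>2) has_sum
           2 * L * (\<kappa> * (LINT x|lborel. (norm (f x))\<^sup>2))) UNIV"
proof -
  define K where "K = sqrt (pi / L)"
  have K: "K > 0" "K\<^sup>2 = pi / L" using L by (auto simp: K_def)
  have Ap: "A * p0 = pi / L" using A by (simp add: p0)
  \<comment> \<open>The group element yields the phase
    \<open>m * (pi / L) * (x + n * q0 / 2)\<close>; the subtracted term compensates for writing
    \<open>x + n * q0\<close> instead.\<close>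
  define u where "u n m = complex_of_real (1 / K) *
      cis (B * (of_int m * p0) - of_int n * q0 * of_int m * (pi / L) / 2)" for n m :: int
  have "((\<lambda>(n, m). (norm (braket f (heis_state A B q0 p0 \<psi> n m)))\<^sup>2) has_sum
      L / pi * (2 * pi * (\<kappa> * (LINT x|lborel. (norm (f x))\<^sup>2)))) UNIV"
  proof (rule windowed_frame_has_sum[where c = "- L" and d = L and \<theta> = "\<lambda>x. pi / L * x"
        and w = "\<lambda>_. K" and q = q0 and u = u])
    show "((\<lambda>x. pi / L * x) has_real_derivative K\<^sup>2) (at x)" for x
      unfolding K(2) using L by (auto intro!: derivative_eq_intros)
    show "(norm (u n m))\<^sup>2 = L / pi" for n m
      using K by (simp add: u_def norm_mult norm_divide power_mult_distrib power_divide)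
    show "heis_state A B q0 p0 \<psi> n m x = u n m * (of_real K *
        cis (of_int m * (pi / L * (x + of_int n * q0))) * \<psi> (x + of_int n * q0))" for n m x
    proof -
      have "A * (of_int n * q0 * of_int m * p0 / 2 + x * (of_int m * p0)) + B * (of_int m * p0) =
          (A * p0) * (of_int n * q0 * of_int m / 2 + x * of_int m) + B * (of_int m * p0)"
        by (simp add: algebra_simps)
      also have "\<dots> = (B * (of_int m * p0) - of_int n * q0 * of_int m * (pi / L) / 2)
          + of_int m * (pi / L * (x + of_int n * q0))"
        unfolding Ap using L by (simp add: field_simps)
      finally have phase: "cis (A * (of_int n * q0 * of_int m * p0 / 2 + x * (of_int m * p0)) + B * (of_int m * p0)) =
          cis (B * (of_int m * p0) - of_int n * q0 * of_int m * (pi / L) / 2)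
          * cis (of_int m * (pi / L * (x + of_int n * q0)))"
        by (simp only: cis_mult)
      show ?thesis
        unfolding heis_state_def heis_rep.simps phase u_def using K(1) by (simp add: add.commute)
    qed
  qed (use L K f \<psi> supp tiling in \<open>auto simp: L2_def field_simps\<close>)
  then show ?thesis by (simp add: mult_ac)
qed

theorem mainTheorem9:
  fixes A B a0 b0 L p0 q0 \<kappa> :: real
    and a b :: "real \<Rightarrow> real"
    and \<psi> f :: "real \<Rightarrow> complex"
  assumes "A \<noteq> 0"
    and "a0 + b0 = B"
    and "\<And>\<epsilon>. \<epsilon> \<in> {0<..1} \<Longrightarrow> a \<epsilon> = a0 + A / \<epsilon>"
    and "\<And>\<epsilon>. \<epsilon> \<in> {0<..1} \<Longrightarrow> b \<epsilon> = b0 - A / \<epsilon>"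
    and "\<And>\<epsilon>. \<epsilon> \<in> {0<..1} \<Longrightarrow> b \<epsilon> \<noteq> 0"
    and "L > 0"
    and "\<psi> \<in> L2"
    and "\<not> (AE x in lborel. \<psi> x = 0)"
    and "AE x in lborel. x \<notin> {-L..L} \<longrightarrow> \<psi> x = 0"
    and "p0 = pi / (A * L)"
    and "\<bar>q0 * p0\<bar> < 2 * pi"
    and "\<kappa> > 0"
    and "\<And>x. ((\<lambda>n::int. (norm (\<psi> (x + of_int n * q0)))\<^sup>2) has_sum \<kappa>) UNIV"
    and "f \<in> L2"
  shows "(\<forall>\<epsilon>\<in>{0<..1}.
            (\<lambda>(n, m). (norm (braket f (aff_state \<epsilon> (a \<epsilon>) (b \<epsilon>) L q0 \<psi> n m)))\<^sup>2)
              summable_on (UNIV :: (int \<times> int) set)) \<and>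
         (\<lambda>(n, m). (norm (braket f (heis_state A B q0 p0 \<psi> n m)))\<^sup>2)
           summable_on (UNIV :: (int \<times> int) set) \<and>
         ((\<lambda>\<epsilon>. \<Sum>\<^sub>\<infinity>(n, m)\<in>(UNIV :: (int \<times> int) set).
              (norm (braket f (aff_state \<epsilon> (a \<epsilon>) (b \<epsilon>) L q0 \<psi> n m)))\<^sup>2)
            \<longlongrightarrow> (\<Sum>\<^sub>\<infinity>(n, m)\<in>(UNIV :: (int \<times> int) set).
              (norm (braket f (heis_state A B q0 p0 \<psi> n m)))\<^sup>2)) (at_right 0)"
proof -
  define N where "N = \<kappa> * (LINT x|lborel. (norm (f x))\<^sup>2)"
  have aff: "((\<lambda>(n, m). (norm (braket f (aff_state \<epsilon> (a \<epsilon>) (b \<epsilon>) L q0 \<psi> n m)))\<^sup>2) has_sum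
      (exp (\<epsilon> * L) - exp (- \<epsilon> * L)) / \<epsilon> * N) UNIV" if "\<epsilon> \<in> {0<..1}" for \<epsilon>
    unfolding N_def using that assms by (intro aff_state_has_sum) auto
  have heis: "((\<lambda>(n, m). (norm (braket f (heis_state A B q0 p0 \<psi> n m)))\<^sup>2) has_sum 2 * L * N) UNIV"
    unfolding N_def using assms by (intro heis_state_has_sum) auto
  \<comment> \<open>The function vanishes at 0, so its quotient by \<open>\<epsilon>\<close> is a
    difference quotient and converges to this derivative.\<close>
  have "((\<lambda>\<epsilon>. exp (\<epsilon> * L) - exp (- \<epsilon> * L)) has_real_derivative 2 * L) (at 0)"
    by (auto intro!: derivative_eq_intros)
  then have "((\<lambda>\<epsilon>. (exp (\<epsilon> * L) - exp (- \<epsilon> * L)) / \<epsilon>) \<longlongrightarrow> 2 * L) (at 0)"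
    by (simp add: has_field_derivative_iff)
  then have "((\<lambda>\<epsilon>. (exp (\<epsilon> * L) - exp (- \<epsilon> * L)) / \<epsilon> * N) \<longlongrightarrow> 2 * L * N) (at_right 0)"
    by (intro tendsto_mult_right) (auto intro: tendsto_mono at_le)
  \<comment> \<open>The closed form of the affine sum is available only for
    \<open>\<epsilon>\<close> in \<open>{0<..1}\<close>, which suffices for a limit from the
    right.\<close>
  moreover have "\<forall>\<^sub>F \<epsilon> in at_right 0. (exp (\<epsilon> * L) - exp (- \<epsilon> * L)) / \<epsilon> * N =
      (\<Sum>\<^sub>\<infinity>(n, m)\<in>(UNIV :: (int \<times> int) set). (norm (braket f (aff_state \<epsilon> (a \<epsilon>) (b \<epsilon>) L q0 \<psi> n m)))\<^sup>2)"
    unfolding eventually_at_right_field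
    by (intro exI[of _ 1] conjI allI impI infsumI[OF aff, symmetric]) auto
  ultimately have "((\<lambda>\<epsilon>. \<Sum>\<^sub>\<infinity>(n, m)\<in>(UNIV :: (int \<times> int) set).
      (norm (braket f (aff_state \<epsilon> (a \<epsilon>) (b \<epsilon>) L q0 \<psi> n m)))\<^sup>2) \<longlongrightarrow> 2 * L * N) (at_right 0)"
    by (rule Lim_transform_eventually)
  then show ?thesis
    using aff[THEN has_sum_imp_summable] has_sum_imp_summable[OF heis] infsumI[OF heis] by auto
qed

end
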